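(* Let $p$ be a prime and let $\mathcal{C}_1\subset\mathcal{C}_2\subset\mathcal{C}_1^{\perp}$ be codes of length $n$ over $\mathbf{Z}_p$, with $\dim\mathcal{C}_1=k_1$ and $\dim\mathcal{C}_2=k_1+k_2$. If $p=2$, assume in addition that $\mathcal{C}_1$ is doubly even. Then the number of self-orthogonal codes $\mathcal{C}$ of length $n$ over $\mathbf{Z}_{p^2}$ such that $\pi(\mathcal{C})=\mathcal{C}_1$ and $\iota^{-1}(\mathcal{C})=\mathcal{C}_2$ is $p^{k_1(2n-3k_1-1-2k_2)/2}$ if $p$ is odd, and $2^{k_1(2n-3k_1+1-2k_2)/2}$ if $p=2$.
   Context: A code of length $n$ over $\mathbf{Z}_m$ is a $\mathbf{Z}_m$-submodule of $\mathbf{Z}_m^n$. $\mathcal{C}^\perp$ denotes the dual with respect to the standard inner product $x\cdot y=\sum x_iy_i$; a code is self-orthogonal if $\mathcal{C}\subset\mathcal{C}^\perp$. Let $\iota:\mathbf{Z}_p^n\to\mathbf{Z}_{p^2}^n$ be the coordinatewise injective homomorphism induced by $\mathbf{Z}_p\cong p\mathbf{Z}_{p^2}\subset\mathbf{Z}_{p^2}$ (i.e. $x\bmod p\mapsto px\bmod p^2$), and $\pi:\mathbf{Z}_{p^2}^n\to\mathbf{Z}_p^n$ the coordinatewise reduction mod $p$. For a code $\mathcal{C}$ over $\mathbf{Z}_{p^2}$, $\pi(\mathcal{C})$ is its residue code and $\iota^{-1}(\mathcal{C})$ its torsion code. A binary code is doubly even if every codeword has Hamming weight divisible by $4$. *)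

theory Defs
  imports Complex_Main "HOL-Number_Theory.Residues" "Jordan_Normal_Form.Missing_VectorSpace"
begin

text \<open>
  \<^const>\<open>residue_ring\<close> represents the ring of integers modulo \<open>m\<close> by the representatives
  \<open>{0..m - 1}\<close>. A word of length \<open>n\<close> is a function on the coordinates \<open>{..<n}\<close>, extended by
  \<open>undefined\<close>, so that equality of words is equality of functions.
\<close>

definition word_module :: "nat \<Rightarrow> nat \<Rightarrow> (int, nat \<Rightarrow> int) module"
  where "word_module m n = ring.func_space (residue_ring (int m)) {..<n}"

definition is_code :: "nat \<Rightarrow> nat \<Rightarrow> (nat \<Rightarrow> int) set \<Rightarrow> bool"
  where "is_code m n C \<longleftrightarrow> submodule (residue_ring (int m)) C (word_module m n)"

text \<open>The dimension of a code as a vector space; meaningful for a prime modulus \<open>p\<close>.\<close>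

definition code_dim :: "nat \<Rightarrow> nat \<Rightarrow> (nat \<Rightarrow> int) set \<Rightarrow> nat"
  where "code_dim p n C =
    vectorspace.dim (residue_ring (int p)) ((word_module p n)\<lparr>carrier := C\<rparr>)"

definition inner_product :: "nat \<Rightarrow> nat \<Rightarrow> (nat \<Rightarrow> int) \<Rightarrow> (nat \<Rightarrow> int) \<Rightarrow> int"
  where "inner_product m n x y =
    (\<Oplus>\<^bsub>residue_ring (int m)\<^esub>i\<in>{..<n}. x i \<otimes>\<^bsub>residue_ring (int m)\<^esub> y i)"

definition dual_code :: "nat \<Rightarrow> nat \<Rightarrow> (nat \<Rightarrow> int) set \<Rightarrow> (nat \<Rightarrow> int) set"
  where "dual_code m n C =
    {x \<in> carrier (word_module m n). \<forall>y\<in>C. inner_product m n x y = \<zero>\<^bsub>residue_ring (int m)\<^esub>}"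

definition self_orthogonal :: "nat \<Rightarrow> nat \<Rightarrow> (nat \<Rightarrow> int) set \<Rightarrow> bool"
  where "self_orthogonal m n C \<longleftrightarrow> C \<subseteq> dual_code m n C"

definition hamming_weight :: "nat \<Rightarrow> (nat \<Rightarrow> int) \<Rightarrow> nat"
  where "hamming_weight n x = card {i \<in> {..<n}. x i \<noteq> 0}"

definition doubly_even :: "nat \<Rightarrow> (nat \<Rightarrow> int) set \<Rightarrow> bool"
  where "doubly_even n C \<longleftrightarrow> (\<forall>x\<in>C. 4 dvd hamming_weight n x)"

text \<open>
  The maps \<open>\<pi>\<close> (reduction of words modulo \<open>p\<^sup>2\<close> to words modulo \<open>p\<close>) and \<open>\<iota>\<close> (the embedding
  \<open>x mod p \<mapsto> p x mod p\<^sup>2\<close>), on the chosen representatives.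
\<close>

definition reduction :: "nat \<Rightarrow> nat \<Rightarrow> (nat \<Rightarrow> int) \<Rightarrow> (nat \<Rightarrow> int)"
  where "reduction p n x = (\<lambda>i\<in>{..<n}. x i mod int p)"

definition embedding :: "nat \<Rightarrow> nat \<Rightarrow> (nat \<Rightarrow> int) \<Rightarrow> (nat \<Rightarrow> int)"
  where "embedding p n x = (\<lambda>i\<in>{..<n}. (int p * x i) mod int (p ^ 2))"

definition residue_code :: "nat \<Rightarrow> nat \<Rightarrow> (nat \<Rightarrow> int) set \<Rightarrow> (nat \<Rightarrow> int) set"
  where "residue_code p n C = reduction p n ` C"

definition torsion_code :: "nat \<Rightarrow> nat \<Rightarrow> (nat \<Rightarrow> int) set \<Rightarrow> (nat \<Rightarrow> int) set"
  where "torsion_code p n C = {x \<in> carrier (word_module p n). embedding p n x \<in> C}"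

end

theory Submission
  imports Defs
begin

text \<open>
  Fix a basis \<open>x\<^sub>1, \<dots>, x\<^sub>k\<close> of \<open>C1\<close>, where \<open>k = k1\<close>, and count the tuples \<open>g\<close> of pairwise (and
  self-) orthogonal words modulo \<open>p\<^sup>2\<close> that lift \<open>x\<close>. Each code with residue \<open>C1\<close> and torsion \<open>C2\<close>
  contains exactly \<open>\<bar>C2\<bar>\<close> lifts of each \<open>x\<^sub>j\<close>, and each tuple \<open>g\<close> lies in exactly one such code,
  namely the span of \<open>g\<close> and \<open>p C2\<close>; so the number of codes is the number of tuples divided by
  \<open>\<bar>C2\<bar>\<^sup>k\<close>. The tuples are counted one entry at a time: writing the next entry as \<open>x\<^sub>j + p y\<close>, the
  orthogonality relations become independent linear equations \<open>x\<^sub>i \<cdot> y = c\<^sub>i\<close> modulo \<open>p\<close>, for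
  \<open>i \<le> j\<close> if \<open>p\<close> is odd and for \<open>i < j\<close> if \<open>p = 2\<close>.
\<close>

section \<open>Codes as sets of integer words\<close>

definition words :: "nat \<Rightarrow> nat \<Rightarrow> (nat \<Rightarrow> int) set"
  where "words m n = {..<n} \<rightarrow>\<^sub>E {0..<int m}"

text \<open>The sum stays an unreduced integer, so that one value can be read modulo
  \<open>p\<close> and modulo \<open>p^2\<close> and can be divided by \<open>p\<close>.\<close>

definition dot :: "nat \<Rightarrow> (nat \<Rightarrow> int) \<Rightarrow> (nat \<Rightarrow> int) \<Rightarrow> int"
  where "dot n x y = (\<Sum>i<n. x i * y i)"

text \<open>Independence over \<open>Z_p\<close> of the residues of integer vectors. Entries and
  coefficients are arbitrary integers, so elimination steps need no normalisation.\<close>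

definition lin_indep_mod :: "nat \<Rightarrow> nat \<Rightarrow> nat \<Rightarrow> (nat \<Rightarrow> nat \<Rightarrow> int) \<Rightarrow> bool"
  where "lin_indep_mod p n k x \<longleftrightarrow>
    (\<forall>a :: nat \<Rightarrow> int. (\<forall>i<n. int p dvd (\<Sum>j<k. a j * x j i)) \<longrightarrow> (\<forall>j<k. int p dvd a j))"

section \<open>Bilinearity of the integer inner product\<close>

lemma dot_commute: "dot n x y = dot n y x"
  by (simp add: dot_def mult.commute)

lemma dot_add_right: "dot n x (\<lambda>i. y i + z i) = dot n x y + dot n x z"
  by (simp add: dot_def algebra_simps sum.distrib)

lemma dot_scale_right: "dot n x (\<lambda>i. c * y i) = c * dot n x y"
  by (simp add: dot_def algebra_simps sum_distrib_left)

lemma dot_add_left: "dot n (\<lambda>i. x i + y i) z = dot n x z + dot n y z"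
  by (simp add: dot_def algebra_simps sum.distrib)

lemma dot_scale_left: "dot n (\<lambda>i. c * x i) y = c * dot n x y"
  by (simp add: dot_def algebra_simps sum_distrib_left)

lemma dot_sum_right: "dot n x (\<lambda>i. \<Sum>j\<in>A. f j i) = (\<Sum>j\<in>A. dot n x (f j))"
  unfolding dot_def by (subst sum.swap) (simp add: sum_distrib_left)

lemma dot_cong:
  assumes "\<And>i. i < n \<Longrightarrow> [x i = x' i] (mod m)" "\<And>i. i < n \<Longrightarrow> [y i = y' i] (mod m)"
  shows "[dot n x y = dot n x' y'] (mod m)"
  unfolding dot_def using assms by (intro cong_sum cong_mult) auto

section \<open>Words as canonical representatives of residue vectors\<close>

lemma reduction_in_words: "m > 0 \<Longrightarrow> reduction m n x \<in> words m n"
  by (auto simp: reduction_def words_def)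

lemma reduction_cong: "i < n \<Longrightarrow> [reduction m n x i = x i] (mod int m)"
  by (simp add: reduction_def cong_def)

text \<open>Reduces later equations between words to congruences of integers, since congruent
  entries of \<open>{0..<int m}\<close> coincide.\<close>

lemma word_eqI:
  assumes "x \<in> words m n" "y \<in> words m n" "\<And>i. i < n \<Longrightarrow> [x i = y i] (mod int m)"
  shows "x = y"
proof (rule PiE_ext[OF assms(1,2)[unfolded words_def]])
  fix i assume "i \<in> {..<n}"
  then have "x i \<in> {0..<int m}" "y i \<in> {0..<int m}" "[x i = y i] (mod int m)"
    using PiE_mem[OF assms(1)[unfolded words_def]] PiE_mem[OF assms(2)[unfolded words_def]]
      assms(3)[of i] by blast+
  then show "x i = y i"
    by (simp add: cong_def)
qed

lemma reduction_eqI: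
  assumes "m > 0" "y \<in> words m n" "\<And>i. i < n \<Longrightarrow> [x i = y i] (mod int m)"
  shows "reduction m n x = y"
  by (rule word_eqI[OF reduction_in_words[OF assms(1)] assms(2)])
    (metis assms(3) cong_trans reduction_cong)

lemma embedding_eq: "embedding p n x = reduction (p ^ 2) n (\<lambda>i. int p * x i)"
  by (simp add: embedding_def reduction_def)

lemma finite_words: "finite (words m n)"
  unfolding words_def by (intro finite_PiE) auto

lemma card_words: "card (words m n) = m ^ n"
  by (simp add: words_def card_PiE)

section \<open>Module notions over \<open>Z_m\<close> rewritten as integer congruences\<close>

context
  fixes m :: nat
  assumes m: "m > 1"
begin

interpretation residues "int m" "residue_ring (int m)"
  using m by unfold_locales auto

lemma word_module_simps:
  "carrier (word_module m n) = words m n"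
  "\<zero>\<^bsub>word_module m n\<^esub> = reduction m n (\<lambda>_. 0)"
  "x \<oplus>\<^bsub>word_module m n\<^esub> y = reduction m n (\<lambda>i. x i + y i)"
  "c \<odot>\<^bsub>word_module m n\<^esub> x = reduction m n (\<lambda>i. c * x i)"
proof -
  have carrier: "{0..int m - 1} = {0..<int m}"
    by auto
  show "carrier (word_module m n) = words m n"
    unfolding word_module_def func_space_def words_def by (simp add: residue_ring_def carrier)
qed (simp_all add: word_module_def func_space_def reduction_def, simp_all add: residue_ring_def)

lemma module_word_module: "module (residue_ring (int m)) (word_module m n)"
  unfolding word_module_def by (rule func_space_is_module)

lemma inner_product_eq: "inner_product m n x y = dot n x y mod int m"
proof -
  have "inner_product m n x y = (\<Oplus>\<^bsub>residue_ring (int m)\<^esub>i\<in>{..<n}. (x i * y i) mod int m)"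
    by (simp add: inner_product_def residue_ring_def)
  also have "\<dots> = dot n x y mod int m"
    by (subst sum_cong) (auto simp: dot_def)
  finally show ?thesis .
qed

lemma dual_code_eq:
  "dual_code m n C = {x \<in> words m n. \<forall>y\<in>C. int m dvd dot n x y}"
  by (auto simp: dual_code_def inner_product_eq word_module_simps res_zero_eq)

text \<open>A single closure condition with integer coefficients covers addition, scaling and, with
  both coefficients 0, the zero word; \<open>reduction\<close> absorbs the unreduced
  scalars.\<close>

lemma is_code_iff:
  "is_code m n C \<longleftrightarrow> C \<subseteq> words m n \<and> C \<noteq> {} \<and>
     (\<forall>x\<in>C. \<forall>y\<in>C. \<forall>a b. reduction m n (\<lambda>i. a * x i + b * y i) \<in> C)"
    (is "?L \<longleftrightarrow> ?R")
proof
  assume L: ?L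
  then interpret submodule "residue_ring (int m)" C "word_module m n"
    by (simp add: is_code_def)
  have scale: "reduction m n (\<lambda>i. a * x i) \<in> C" if "x \<in> C" for a x
  proof -
    \<comment> \<open>An integer scalar acts like its residue, and only the residue is guaranteed to
      lie in the carrier of the ring.\<close>
    have "(a mod int m) \<odot>\<^bsub>word_module m n\<^esub> x \<in> C"
      using that by (intro smult_closed) auto
    also have "(a mod int m) \<odot>\<^bsub>word_module m n\<^esub> x = reduction m n (\<lambda>i. a * x i)"
      unfolding word_module_simps by (simp add: reduction_def mod_simps)
    finally show ?thesis .
  qed
  have "reduction m n (\<lambda>i. a * x i + b * y i) \<in> C" if "x \<in> C" "y \<in> C" for a b x y
  proof -
    have "reduction m n (\<lambda>i. a * x i) \<oplus>\<^bsub>word_module m n\<^esub> reduction m n (\<lambda>i. b * y i) \<in> C"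
      using that by (intro m_closed scale)
    also have "reduction m n (\<lambda>i. a * x i) \<oplus>\<^bsub>word_module m n\<^esub> reduction m n (\<lambda>i. b * y i)
      = reduction m n (\<lambda>i. a * x i + b * y i)"
      unfolding word_module_simps by (auto simp: reduction_def mod_simps intro!: restrict_ext)
    finally show ?thesis .
  qed
  then show ?R
    using subset zero_closed by (auto simp: word_module_simps)
next
  assume R: ?R
  have comb: "reduction m n (\<lambda>i. a * x i + b * y i) \<in> C" if "x \<in> C" "y \<in> C" for a b x y
    using R that by blast
  obtain x where "x \<in> C" using R by auto
  from comb[OF this this, of 0 0] have "reduction m n (\<lambda>_. 0) \<in> C"
    by simp
  then show ?L
    unfolding is_code_def submodule_def
    using R module_word_module comb[of _ _ 1 1] comb[of _ _ _ 0]
    by (auto simp: word_module_simps)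
qed

lemma code_subset_words: "is_code m n C \<Longrightarrow> C \<subseteq> words m n"
  by (simp add: is_code_iff)

lemma code_nonempty: "is_code m n C \<Longrightarrow> C \<noteq> {}"
  by (simp add: is_code_iff)

lemma code_lincomb_closed:
  assumes "is_code m n C" "x \<in> C" "y \<in> C"
  shows "reduction m n (\<lambda>i. a * x i + b * y i) \<in> C"
  using assms(1)[unfolded is_code_iff] assms(2,3) by simp

lemma self_orthogonal_iff:
  assumes "is_code m n C"
  shows "self_orthogonal m n C \<longleftrightarrow> (\<forall>x\<in>C. \<forall>y\<in>C. int m dvd dot n x y)"
  using code_subset_words[OF assms] unfolding self_orthogonal_def dual_code_eq by blast

lemma code_sum_closed:
  fixes x :: "nat \<Rightarrow> nat \<Rightarrow> int"
  assumes C: "is_code m n C" and x: "\<And>j. j < k \<Longrightarrow> x j \<in> C"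
  shows "reduction m n (\<lambda>i. \<Sum>j<k. a j * x j i) \<in> C"
  using x
proof (induction k)
  case 0
  \<comment> \<open>The empty sum is the zero word, which is the trivial combination of any
    codeword.\<close>
  obtain y where "y \<in> C" using code_nonempty[OF C] by auto
  then have "reduction m n (\<lambda>i. 0 * y i + 0 * y i) \<in> C"
    by (intro code_lincomb_closed C)
  then show ?case by simp
next
  case (Suc k)
  then have "reduction m n (\<lambda>i. 1 * reduction m n (\<lambda>i. \<Sum>j<k. a j * x j i) i + a k * x k i) \<in> C"
    by (intro code_lincomb_closed C) auto
  also have "reduction m n (\<lambda>i. 1 * reduction m n (\<lambda>i. \<Sum>j<k. a j * x j i) i + a k * x k i)
     = reduction m n (\<lambda>i. \<Sum>j<Suc k. a j * x j i)"
    by (auto simp: reduction_def mod_simps intro!: restrict_ext)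
  finally show ?case .
qed

end

text \<open>Transfers a vector space basis to integer congruences: the basis \<open>B\<close> is
  enumerated as \<open>x\<close>, and linear combinations over the residue ring agree modulo
  \<open>p\<close> with integer sums.\<close>

lemma code_basis:
  assumes p: "prime p" and C: "is_code p n C" and dim: "code_dim p n C = k"
  obtains x where "\<And>j. j < k \<Longrightarrow> x j \<in> C" "lin_indep_mod p n k x"
    "\<And>w. w \<in> C \<Longrightarrow> \<exists>a. \<forall>i<n. [w i = (\<Sum>j<k. a j * x j i)] (mod int p)"
proof -
  interpret residues_prime p "residue_ring (int p)"
    using p by unfold_locales auto
  have p1: "p > 1"
    using p prime_gt_1_nat by auto
  let ?R = "residue_ring (int p)" and ?M = "word_module p n"
  let ?V = "?M\<lparr>carrier := C\<rparr>"
  have CW: "C \<subseteq> words p n"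
    by (rule code_subset_words[OF p1 C])
  interpret M: module ?R ?M
    by (rule module_word_module[OF p1])
  interpret V: vectorspace ?R ?V
    using M.submodule_is_module[of C] C is_field
    unfolding vectorspace_def is_code_def by simp
  have finC: "finite C"
    using CW finite_words finite_subset by blast
  have V_simps: "carrier ?V = C" "\<zero>\<^bsub>?V\<^esub> = reduction p n (\<lambda>_. 0)"
    "u \<oplus>\<^bsub>?V\<^esub> v = reduction p n (\<lambda>i. u i + v i)"
    "c \<odot>\<^bsub>?V\<^esub> u = reduction p n (\<lambda>i. c * u i)" for u v c
    by (simp_all add: word_module_simps[OF p1])
  \<comment> \<open>The finite set \<open>C\<close> spans itself.\<close>
  have "V.fin_dim"
    unfolding V.fin_dim_def using finC V.span_is_subset2[of C] V.in_own_span[of C]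
    by (intro exI[of _ C]) auto
  then obtain B where B: "finite B" "V.basis B"
    using V.finite_basis_exists by blast
  have cardB: "card B = k"
    using V.dim_basis[OF B] dim by (simp add: code_dim_def)
  have li: "V.lin_indpt B" and gen: "V.span B = C" and BC: "B \<subseteq> C"
    using B by (auto simp: V.basis_def)
  have lincomb: "[V.lincomb a A i = (\<Sum>v\<in>A. a v * v i)] (mod int p)"
    if "finite A" "A \<subseteq> C" "a \<in> A \<rightarrow> carrier ?R" "i < n" for a A i
    using that
  proof (induction A)
    case empty
    then show ?case by (simp add: V.lincomb_def V_simps reduction_def cong_def)
  next
    case (insert v A)
    have "V.lincomb a (insert v A) = a v \<odot>\<^bsub>?V\<^esub> v \<oplus>\<^bsub>?V\<^esub> V.lincomb a A"
      using V.lincomb_insert[of A a v] insert by auto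
    then have "[V.lincomb a (insert v A) i = reduction p n (\<lambda>i. a v * v i) i + V.lincomb a A i] (mod int p)"
      unfolding V_simps using reduction_cong[OF \<open>i < n\<close>] by simp
    moreover have "[reduction p n (\<lambda>i. a v * v i) i + V.lincomb a A i
        = a v * v i + (\<Sum>v\<in>A. a v * v i)] (mod int p)"
      using insert by (intro cong_add reduction_cong) auto
    ultimately show ?case
      using insert by (auto intro: cong_trans)
  qed
  obtain x where x: "bij_betw x {..<k} B"
    using ex_bij_betw_nat_finite[OF B(1)] cardB by (auto simp: atLeast0LessThan)
  have sumx: "(\<Sum>v\<in>B. f v) = (\<Sum>j<k. f (x j))" for f :: "(nat \<Rightarrow> int) \<Rightarrow> int"
    using sum.reindex_bij_betw[OF x] by metis
  show thesis
  proof
    show "x j \<in> C" if "j < k" for j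
      using x that BC by (auto simp: bij_betw_def)
    show "lin_indep_mod p n k x"
      unfolding lin_indep_mod_def
    proof (intro allI impI)
      fix a :: "nat \<Rightarrow> int" and j
      assume a: "\<forall>i<n. int p dvd (\<Sum>j<k. a j * x j i)" and "j < k"
      \<comment> \<open>\<open>b\<close> carries the coefficients from indices to basis vectors and
        reduces them, so that they become scalars of the residue ring.\<close>
      define b where "b v = a (inv_into {..<k} x v) mod int p" for v
      have bx: "b (x j) = a j mod int p" if "j < k" for j
        using x that by (simp add: b_def bij_betw_def)
      have bR: "b \<in> B \<rightarrow> carrier ?R"
        by (auto simp: b_def)
      have "V.lincomb b B = \<zero>\<^bsub>?V\<^esub>"
      proof (rule word_eqI)
        show "V.lincomb b B \<in> words p n"
          using V.lincomb_closed[of B b] BC bR CW by auto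
        show "\<zero>\<^bsub>?V\<^esub> \<in> words p n"
          unfolding V_simps using p1 by (intro reduction_in_words) auto
        fix i assume i: "i < n"
        have "[V.lincomb b B i = (\<Sum>j<k. b (x j) * x j i)] (mod int p)"
          using lincomb[OF B(1) BC bR i] by (simp add: sumx)
        also have "[(\<Sum>j<k. b (x j) * x j i) = (\<Sum>j<k. a j * x j i)] (mod int p)"
          by (intro cong_sum cong_mult) (auto simp: bx)
        also have "[(\<Sum>j<k. a j * x j i) = 0] (mod int p)"
          using a i by (simp add: cong_0_iff)
        finally show "[V.lincomb b B i = \<zero>\<^bsub>?V\<^esub> i] (mod int p)"
          unfolding V_simps using i by (simp add: reduction_def)
      qed
      then have "b (x j) = 0"
        using V.lin_dep_crit[OF B(1) subset_refl bR] li x \<open>j < k\<close> 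
        by (auto simp: bij_betw_def res_zero_eq)
      then show "int p dvd a j"
        using bx[OF \<open>j < k\<close>] by auto
    qed
    show "\<exists>a. \<forall>i<n. [w i = (\<Sum>j<k. a j * x j i)] (mod int p)" if w: "w \<in> C" for w
    proof -
      obtain b where b: "b \<in> B \<rightarrow> carrier ?R" "V.lincomb b B = w"
        using V.finite_in_span[of B w, unfolded V_simps, OF B(1) BC] w gen by auto
      show ?thesis
        using lincomb[OF B(1) BC b(1)] by (intro exI[of _ "\<lambda>j. b (x j)"]) (simp add: b(2) sumx)
    qed
  qed
qed

text \<open>Coefficient vectors, taken as words of length \<open>k\<close>, correspond bijectively
  to codewords: independence gives injectivity and spanning gives surjectivity.\<close>

lemma card_code:
  assumes p: "prime p" and C: "is_code p n C" and dim: "code_dim p n C = k"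
  shows "card C = p ^ k"
proof -
  have p1: "p > 1"
    using p prime_gt_1_nat by auto
  have CW: "C \<subseteq> words p n"
    by (rule code_subset_words[OF p1 C])
  from code_basis[OF assms] obtain x where x: "\<And>j. j < k \<Longrightarrow> x j \<in> C"
    and li: "lin_indep_mod p n k x"
    and span: "\<And>w. w \<in> C \<Longrightarrow> \<exists>a. \<forall>i<n. [w i = (\<Sum>j<k. a j * x j i)] (mod int p)"
    by blast
  define F where "F a = reduction p n (\<lambda>i. \<Sum>j<k. a j * x j i)" for a :: "nat \<Rightarrow> int"
  have "bij_betw F (words p k) C"
    unfolding bij_betw_def
  proof (intro conjI equalityI subsetI)
    show "inj_on F (words p k)"
    proof (rule inj_onI)
      fix a b assume ab: "a \<in> words p k" "b \<in> words p k" and "F a = F b"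
      have "int p dvd (\<Sum>j<k. (a j - b j) * x j i)" if "i < n" for i
      proof -
        have "F a i = F b i"
          using \<open>F a = F b\<close> by simp
        then have "[(\<Sum>j<k. a j * x j i) = (\<Sum>j<k. b j * x j i)] (mod int p)"
          using that by (simp add: F_def reduction_def cong_def)
        then show ?thesis
          by (simp add: cong_iff_dvd_diff left_diff_distrib sum_subtractf)
      qed
      then have "int p dvd a j - b j" if "j < k" for j
        using that li[unfolded lin_indep_mod_def, rule_format, of "\<lambda>j. a j - b j"] by blast
      then show "a = b"
        by (intro word_eqI[OF ab]) (simp add: cong_iff_dvd_diff)
    qed
    show "w \<in> C" if "w \<in> F ` words p k" for w
      using that code_sum_closed[OF p1 C x] by (auto simp: F_def)
    show "w \<in> F ` words p k" if w: "w \<in> C" for w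
    proof -
      obtain a where a: "\<forall>i<n. [w i = (\<Sum>j<k. a j * x j i)] (mod int p)"
        using span[OF w] by blast
      have "F (reduction p k a) = w"
        unfolding F_def
      proof (rule reduction_eqI)
        show "p > 0" "w \<in> words p n" using p1 w CW by auto
        fix i assume "i < n"
        have "[(\<Sum>j<k. reduction p k a j * x j i) = (\<Sum>j<k. a j * x j i)] (mod int p)"
          by (intro cong_sum cong_mult reduction_cong) auto
        with a \<open>i < n\<close> show "[(\<Sum>j<k. reduction p k a j * x j i) = w i] (mod int p)"
          by (meson cong_sym cong_trans)
      qed
      then show ?thesis
        using reduction_in_words[of p k a] p1 by auto
    qed
  qed
  then show ?thesis
    by (metis bij_betw_same_card card_words)
qed

section \<open>Linear systems modulo a prime\<close>

lemma lin_indep_mod_Suc: 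
  assumes "lin_indep_mod p n (Suc k) x"
  shows "lin_indep_mod p n k x"
  unfolding lin_indep_mod_def
proof (intro allI impI)
  fix a :: "nat \<Rightarrow> int" and j
  assume a: "\<forall>i<n. int p dvd (\<Sum>j<k. a j * x j i)" and "j < k"
  define b where "b = a(k := 0)"
  have "(\<Sum>j<Suc k. b j * x j i) = (\<Sum>j<k. a j * x j i)" for i
    by (simp add: b_def)
  then have "int p dvd b j"
    using assms[unfolded lin_indep_mod_def, rule_format, of b j] a \<open>j < k\<close> by simp
  then show "int p dvd a j"
    using \<open>j < k\<close> by (simp add: b_def)
qed

text \<open>Gaussian elimination: the pivot coordinate \<open>t\<close> of the last vector is cleared from the others.\<close>

lemma lin_indep_mod_solvable:
  assumes p: "prime p" and "lin_indep_mod p n k x"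
  shows "\<exists>y. \<forall>j<k. [dot n (x j) y = c j] (mod int p)"
  using assms(2)
proof (induction k arbitrary: x c)
  case 0
  then show ?case by simp
next
  case (Suc k)
  note li = Suc.prems[unfolded lin_indep_mod_def, rule_format]
  \<comment> \<open>If \<open>p\<close> divided every entry of \<open>x k\<close>, the combination
    with the single coefficient 1 at \<open>k\<close> would contradict independence.\<close>
  have "\<exists>t<n. \<not> int p dvd x k t"
  proof (rule ccontr)
    assume "\<not> ?thesis"
    then have "int p dvd (\<Sum>j<Suc k. (if j = k then 1 else 0) * x j i)" if "i < n" for i
      using that by simp
    then have "int p dvd (if k = k then 1 else 0)"
      using li[of "\<lambda>j. if j = k then 1 else 0" k] by blast
    then show False
      using p not_prime_unit by auto
  qed
  then obtain t where t: "t < n" "\<not> int p dvd x k t" by blast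
  then have "coprime (x k t) (int p)"
    using p prime_imp_coprime[of "int p" "x k t"] by (simp add: coprime_commute)
  then obtain u where u: "[x k t * u = 1] (mod int p)"
    using cong_solve_coprime_int by blast
  \<comment> \<open>\<open>u\<close> inverts the pivot modulo \<open>p\<close>, so subtracting
    \<open>q j\<close> times \<open>x k\<close> from \<open>x j\<close> clears coordinate
    \<open>t\<close>.\<close>
  define q where "q j = x j t * u" for j
  define x' where "x' j i = x j i - q j * x k i" for j i
  have x't: "[x' j t = 0] (mod int p)" for j
  proof -
    have "x' j t = x j t - x j t * (x k t * u)"
      by (simp add: x'_def q_def algebra_simps)
    also have "[\<dots> = x j t - x j t * 1] (mod int p)"
      by (intro cong_diff cong_mult u cong_refl)
    finally show ?thesis by simp
  qed
  have "lin_indep_mod p n k x'"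
    unfolding lin_indep_mod_def
  proof (intro allI impI)
    fix a :: "nat \<Rightarrow> int" and j
    assume a: "\<forall>i<n. int p dvd (\<Sum>j<k. a j * x' j i)" and "j < k"
    \<comment> \<open>The coefficient at \<open>k\<close> accounts for the multiples of
      \<open>x k\<close> that were subtracted in \<open>x'\<close>.\<close>
    define b where "b = a(k := - (\<Sum>j<k. a j * q j))"
    have "(\<Sum>j<Suc k. b j * x j i) = (\<Sum>j<k. a j * x' j i)" for i
      by (simp add: b_def x'_def algebra_simps sum_subtractf sum_distrib_left)
    then have "int p dvd b j"
      using li[of b j] a \<open>j < k\<close> by simp
    then show "int p dvd a j"
      using \<open>j < k\<close> by (simp add: b_def)
  qed
  \<comment> \<open>The right-hand sides undergo the same elimination as the vectors.\<close>
  from Suc.IH[OF this, of "\<lambda>j. c j - q j * c k"] obtain y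
    where y: "\<And>j. j < k \<Longrightarrow> [dot n (x' j) y = c j - q j * c k] (mod int p)" by blast
  \<comment> \<open>Changing \<open>y\<close> by \<open>s\<close> at coordinate \<open>t\<close>
    keeps the products with the cleared vectors \<open>x'\<close> modulo \<open>p\<close>, while
    \<open>x k t * u = 1\<close> makes the equation for \<open>x k\<close> hold.\<close>
  define s where "s = u * (c k - dot n (x k) y)"
  define y' where "y' i = y i + (if i = t then s else 0)" for i
  have dot_y': "dot n z y' = dot n z y + z t * s" for z
  proof -
    have "dot n z (\<lambda>i. if i = t then s else 0) = (\<Sum>i<n. if i = t then z t * s else 0)"
      unfolding dot_def by (intro sum.cong) auto
    also have "\<dots> = z t * s"
      using t by simp
    finally show ?thesis
      unfolding y'_def by (simp add: dot_add_right)
  qed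
  have k: "[dot n (x k) y' = c k] (mod int p)"
  proof -
    have "dot n (x k) y' = dot n (x k) y + x k t * u * (c k - dot n (x k) y)"
      by (simp add: dot_y' s_def algebra_simps)
    also have "[\<dots> = dot n (x k) y + 1 * (c k - dot n (x k) y)] (mod int p)"
      by (intro cong_add cong_mult u cong_refl)
    finally show ?thesis by simp
  qed
  have "[dot n (x j) y' = c j] (mod int p)" if "j < k" for j
  proof -
    have "dot n (x j) y' = dot n (x' j) y' + q j * dot n (x k) y'"
      by (simp add: dot_def x'_def algebra_simps sum_subtractf sum_distrib_left)
    also have "\<dots> = dot n (x' j) y + x' j t * s + q j * dot n (x k) y'"
      by (simp add: dot_y')
    also have "[\<dots> = (c j - q j * c k) + 0 * s + q j * c k] (mod int p)"
      by (intro cong_add cong_mult y x't k cong_refl that)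
    finally show ?thesis by simp
  qed
  with k show ?case
    by (intro exI[of _ y']) (auto simp: less_Suc_eq)
qed

lemma dot_reduction: "[dot n z (reduction p n y) = dot n z y] (mod int p)"
  by (intro dot_cong reduction_cong cong_refl)

text \<open>Each further independent equation divides the number of solutions by \<open>p\<close>,
  because its left-hand side takes every value equally often on the solutions of the previous
  ones.\<close>

lemma card_solutions:
  assumes p: "prime p" and "lin_indep_mod p n k x"
  shows "card {y \<in> words p n. \<forall>j<k. [dot n (x j) y = c j] (mod int p)} * p ^ k = p ^ n"
  using assms(2)
proof (induction k)
  case 0
  then show ?case by (simp add: card_words)
next
  case (Suc k)
  define Sol where "Sol k = {y \<in> words p n. \<forall>j<k. [dot n (x j) y = c j] (mod int p)}" for k
  have p0: "p > 0" using p prime_gt_0_nat by auto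
  \<comment> \<open>Adding multiples of \<open>y0\<close> shifts the value of the last equation and
    preserves the other ones.\<close>
  obtain y0 where y0: "\<And>j. j < Suc k \<Longrightarrow> [dot n (x j) y0 = (if j = k then 1 else 0)] (mod int p)"
    using lin_indep_mod_solvable[OF p Suc.prems, of "\<lambda>j. if j = k then 1 else 0"] by blast
  \<comment> \<open>A solution of the first \<open>k\<close> equations is, in a unique way, a
    solution of all \<open>Suc k\<close> equations plus \<open>s * y0\<close> with \<open>s\<close>
    in \<open>{0..<int p}\<close>; \<open>g\<close> reads \<open>s\<close> off as the defect in the
    last equation.\<close>
  define f where "f sy = reduction p n (\<lambda>i. snd sy i + fst sy * y0 i)" for sy :: "int \<times> (nat \<Rightarrow> int)"
  define g where "g y = (let s = (dot n (x k) y - c k) mod int p in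
      (s, reduction p n (\<lambda>i. y i - s * y0 i)))" for y
  have dot_f: "[dot n (x j) (reduction p n (\<lambda>i. y i + s * y0 i))
      = dot n (x j) y + s * (if j = k then 1 else 0)] (mod int p)" if "j < Suc k" for j s y
  proof -
    have "[dot n (x j) (reduction p n (\<lambda>i. y i + s * y0 i)) = dot n (x j) (\<lambda>i. y i + s * y0 i)] (mod int p)"
      by (rule dot_reduction)
    also have "dot n (x j) (\<lambda>i. y i + s * y0 i) = dot n (x j) y + s * dot n (x j) y0"
      by (simp add: dot_add_right dot_scale_right)
    also have "[\<dots> = dot n (x j) y + s * (if j = k then 1 else 0)] (mod int p)"
      by (intro cong_add cong_mult y0 cong_refl that)
    finally show ?thesis .
  qed
  have "bij_betw f ({0..<int p} \<times> Sol (Suc k)) (Sol k)"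
  proof (rule bij_betw_byWitness[where f' = g])
    show "\<forall>sy \<in> {0..<int p} \<times> Sol (Suc k). g (f sy) = sy"
    proof (rule ballI, elim SigmaE)
      fix sy s y assume sy: "sy = (s, y)" and s: "s \<in> {0..<int p}" and y: "y \<in> Sol (Suc k)"
      have "[dot n (x k) (f sy) - c k = (c k + s * 1) - c k] (mod int p)"
      proof (intro cong_diff cong_refl)
        have "[dot n (x k) (f sy) = dot n (x k) y + s * 1] (mod int p)"
          using dot_f[of k y s] by (simp add: f_def sy)
        also have "[dot n (x k) y + s * 1 = c k + s * 1] (mod int p)"
          using y by (intro cong_add cong_refl) (auto simp: Sol_def)
        finally show "[dot n (x k) (f sy) = c k + s * 1] (mod int p)" .
      qed
      then have 1: "(dot n (x k) (f sy) - c k) mod int p = s"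
        using s by (simp add: cong_def)
      have "reduction p n (\<lambda>i. f sy i - s * y0 i) = y"
      proof (rule reduction_eqI[OF p0])
        show "y \<in> words p n" using y by (simp add: Sol_def)
        fix i assume "i < n"
        then have "[f sy i - s * y0 i = (y i + s * y0 i) - s * y0 i] (mod int p)"
          unfolding f_def sy fst_conv snd_conv by (intro cong_diff reduction_cong cong_refl)
        then show "[f sy i - s * y0 i = y i] (mod int p)" by simp
      qed
      then show "g (f sy) = sy"
        by (simp add: g_def Let_def 1[unfolded sy] sy)
    qed
    show "\<forall>y \<in> Sol k. f (g y) = y"
    proof
      fix y assume y: "y \<in> Sol k"
      define s where "s = (dot n (x k) y - c k) mod int p"
      have "reduction p n (\<lambda>i. reduction p n (\<lambda>i. y i - s * y0 i) i + s * y0 i) = y"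
      proof (rule reduction_eqI[OF p0])
        show "y \<in> words p n" using y by (simp add: Sol_def)
        fix i assume "i < n"
        then have "[reduction p n (\<lambda>i. y i - s * y0 i) i + s * y0 i = (y i - s * y0 i) + s * y0 i] (mod int p)"
          by (intro cong_add reduction_cong cong_refl)
        then show "[reduction p n (\<lambda>i. y i - s * y0 i) i + s * y0 i = y i] (mod int p)" by simp
      qed
      then show "f (g y) = y"
        by (simp add: f_def g_def Let_def s_def)
    qed
    show "f ` ({0..<int p} \<times> Sol (Suc k)) \<subseteq> Sol k"
    proof (clarsimp simp: f_def)
      fix s y assume y: "y \<in> Sol (Suc k)"
      have "[dot n (x j) (reduction p n (\<lambda>i. y i + s * y0 i)) = c j] (mod int p)" if "j < k" for j
      proof -
        have "[dot n (x j) (reduction p n (\<lambda>i. y i + s * y0 i)) = dot n (x j) y] (mod int p)"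
          using dot_f[of j y s] that by simp
        also have "[dot n (x j) y = c j] (mod int p)"
          using y that by (simp add: Sol_def)
        finally show ?thesis .
      qed
      then show "reduction p n (\<lambda>i. y i + s * y0 i) \<in> Sol k"
        unfolding Sol_def using reduction_in_words[OF p0] by blast
    qed
    show "g ` Sol k \<subseteq> {0..<int p} \<times> Sol (Suc k)"
    proof (rule image_subsetI)
      fix y assume y: "y \<in> Sol k"
      define s where "s = (dot n (x k) y - c k) mod int p"
      have dots: "[dot n (x j) (reduction p n (\<lambda>i. y i - s * y0 i)) = c j] (mod int p)" if "j < Suc k" for j
      proof (cases "j = k")
        case True
        have "[dot n (x k) y + (- s) * 1 = dot n (x k) y - (dot n (x k) y - c k)] (mod int p)"
          unfolding s_def by (simp add: cong_def mod_simps)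
        with dot_f[of j y "- s"] True show ?thesis
          by (simp add: cong_def)
      next
        case False
        then have "[dot n (x j) (reduction p n (\<lambda>i. y i - s * y0 i)) = dot n (x j) y] (mod int p)"
          using dot_f[of j y "- s"] that by simp
        also have "[dot n (x j) y = c j] (mod int p)"
          using y that False by (simp add: Sol_def)
        finally show ?thesis .
      qed
      have "reduction p n (\<lambda>i. y i - s * y0 i) \<in> Sol (Suc k)"
        unfolding Sol_def using dots reduction_in_words[OF p0] by blast
      moreover have "s \<in> {0..<int p}"
        using p0 by (simp add: s_def)
      ultimately show "g y \<in> {0..<int p} \<times> Sol (Suc k)"
        by (simp add: g_def Let_def s_def)
    qed
  qed
  then have "card (Sol k) = p * card (Sol (Suc k))"
    using bij_betw_same_card by (fastforce simp: card_cartesian_product)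
  with Suc.IH[OF lin_indep_mod_Suc[OF Suc.prems]] show ?case
    by (simp add: Sol_def mult_ac)
qed

section \<open>Orthogonal lifts of a basis\<close>

definition lifts :: "nat \<Rightarrow> nat \<Rightarrow> (nat \<Rightarrow> int) \<Rightarrow> (nat \<Rightarrow> int) set"
  where "lifts p n w = {h \<in> words (p ^ 2) n. \<forall>i<n. [h i = w i] (mod int p)}"

text \<open>Extensional functions, so that each tuple is counted once.\<close>

definition lift_tuples :: "nat \<Rightarrow> nat \<Rightarrow> nat \<Rightarrow> (nat \<Rightarrow> nat \<Rightarrow> int) \<Rightarrow> (nat \<Rightarrow> nat \<Rightarrow> int) set"
  where "lift_tuples p n k x =
    {g \<in> (\<Pi>\<^sub>E j\<in>{..<k}. lifts p n (x j)). \<forall>i<k. \<forall>j<k. (int p)\<^sup>2 dvd dot n (g i) (g j)}"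

section \<open>Passing between congruences modulo \<open>p\<close> and modulo
  \<open>p^2\<close>\<close>

lemma cong_scale_prime: "[a = b] (mod int p) \<Longrightarrow> [int p * a = int p * b] (mod (int p)\<^sup>2)"
  unfolding power2_eq_square cong_iff_dvd_diff by (simp flip: right_diff_distrib)

lemma cong_square_imp: "[a = b] (mod (int p)\<^sup>2) \<Longrightarrow> [a = b] (mod int p)"
  by (rule cong_dvd_modulus) auto

text \<open>Turns orthogonality modulo \<open>p^2\<close> into a condition modulo \<open>p\<close>,
  once the inner product is known to be \<open>p\<close> times an integer.\<close>

lemma square_dvd_iff:
  assumes "p > 0" "[X = int p * A] (mod (int p)\<^sup>2)"
  shows "(int p)\<^sup>2 dvd X \<longleftrightarrow> int p dvd A"
  using assms cong_dvd_iff[OF assms(2)] by (simp add: power2_eq_square)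

lemma reduction_square_cong: "i < n \<Longrightarrow> [reduction (p ^ 2) n x i = x i] (mod (int p)\<^sup>2)"
  using reduction_cong[of i n "p ^ 2" x] by simp

text \<open>\<open>y\<close> is the second base-\<open>p\<close> digit of the lift relative to
  \<open>w\<close>, recovered as \<open>(h - w) / p\<close>. Since \<open>w\<close> is any integer
  vector, lifts can also be described relative to another lift.\<close>

lemma bij_betw_lifts:
  assumes p: "p > 0"
  shows "bij_betw (\<lambda>y. reduction (p ^ 2) n (\<lambda>i. w i + int p * y i)) (words p n) (lifts p n w)"
    (is "bij_betw ?f _ _")
  unfolding bij_betw_def
proof (intro conjI equalityI subsetI)
  show "inj_on ?f (words p n)"
  proof (rule inj_onI)
    fix y z assume yz: "y \<in> words p n" "z \<in> words p n" and eq: "?f y = ?f z"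
    show "y = z"
    proof (rule word_eqI[OF yz])
      fix i assume i: "i < n"
      have "[w i + int p * y i = ?f y i] (mod (int p)\<^sup>2)"
        by (rule cong_sym[OF reduction_square_cong[OF i]])
      also have "[?f y i = w i + int p * z i] (mod (int p)\<^sup>2)"
        unfolding eq by (rule reduction_square_cong[OF i])
      finally have "(int p)\<^sup>2 dvd int p * (y i - z i)"
        by (simp add: cong_iff_dvd_diff algebra_simps)
      then show "[y i = z i] (mod int p)"
        using p by (simp add: power2_eq_square cong_iff_dvd_diff)
    qed
  qed
  show "h \<in> lifts p n w" if "h \<in> ?f ` words p n" for h
  proof -
    from that obtain y where h: "h = ?f y" by blast
    have "[h i = w i] (mod int p)" if "i < n" for i
    proof -
      have "[h i = w i + int p * y i] (mod int p)"
        unfolding h by (rule cong_square_imp[OF reduction_square_cong[OF that]])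
      also have "[w i + int p * y i = w i] (mod int p)"
        by (simp add: cong_iff_dvd_diff)
      finally show ?thesis .
    qed
    then show ?thesis
      using p unfolding lifts_def h by (simp add: reduction_in_words)
  qed
  show "h \<in> ?f ` words p n" if h: "h \<in> lifts p n w" for h
  proof -
    define y where "y = reduction p n (\<lambda>i. (h i - w i) div int p)"
    have "?f y = h"
    proof (rule reduction_eqI)
      show "p ^ 2 > 0" "h \<in> words (p ^ 2) n" using p h by (auto simp: lifts_def)
      fix i assume i: "i < n"
      have "[int p * y i = int p * ((h i - w i) div int p)] (mod (int p)\<^sup>2)"
        unfolding y_def by (intro cong_scale_prime reduction_cong i)
      also have "int p * ((h i - w i) div int p) = h i - w i"
        using h i by (simp add: lifts_def cong_iff_dvd_diff)
      finally have "[w i + int p * y i = w i + (h i - w i)] (mod (int p)\<^sup>2)"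
        by (intro cong_add cong_refl)
      then show "[w i + int p * y i = h i] (mod int (p ^ 2))"
        by simp
    qed
    moreover have "y \<in> words p n"
      unfolding y_def using p by (rule reduction_in_words)
    ultimately show ?thesis by blast
  qed
qed

lemma finite_lifts: "finite (lifts p n w)"
  unfolding lifts_def using finite_words by simp

lemma finite_lift_tuples: "finite (lift_tuples p n k x)"
  unfolding lift_tuples_def using finite_lifts by (simp add: finite_PiE)

text \<open>For \<open>p = 2\<close> the condition on \<open>h \<cdot> h\<close> is automatic, which is the reason for the different
  exponents in the two cases.\<close>

lemma card_lift_extensions:
  assumes p: "prime p" and li: "lin_indep_mod p n (Suc k) x"
    and orth: "\<And>j. j \<le> k \<Longrightarrow> int p dvd dot n (x j) (x k)"
    and even: "p = 2 \<Longrightarrow> 4 dvd dot n (x k) (x k)"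
    and g: "\<And>j. j < k \<Longrightarrow> g j \<in> lifts p n (x j)"
  shows "card {h \<in> lifts p n (x k). (\<forall>j<k. (int p)\<^sup>2 dvd dot n (g j) h) \<and> (int p)\<^sup>2 dvd dot n h h}
    * p ^ (k + (if p = 2 then 0 else 1)) = p ^ n"
proof -
  \<comment> \<open>\<open>e\<close> counts the equations contributed by the product of the new
    entry with itself.\<close>
  define e :: nat where "e = (if p = 2 then 0 else 1)"
  define f where "f y = reduction (p ^ 2) n (\<lambda>i. x k i + int p * y i)" for y
  \<comment> \<open>These values come from expanding the products with \<open>x k + p y\<close>; the
    second branch is for \<open>j = k\<close> and odd \<open>p\<close>, where
    \<open>(p + 1) div 2\<close> is the inverse of 2.\<close>
  define c where "c j = (if j < k then - (dot n (g j) (x k) div int p)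
    else - (dot n (x k) (x k) div int p) * ((int p + 1) div 2))" for j
  define H where "H = {h \<in> lifts p n (x k). (\<forall>j<k. (int p)\<^sup>2 dvd dot n (g j) h) \<and> (int p)\<^sup>2 dvd dot n h h}"
  define Sol where "Sol = {y \<in> words p n. \<forall>j<k + e. [dot n (x j) y = c j] (mod int p)}"
  have p0: "p > 0" using p prime_gt_0_nat by auto
  have f_cong: "[f y i = x k i + int p * y i] (mod (int p)\<^sup>2)" if "i < n" for y i
    unfolding f_def by (rule reduction_square_cong[OF that])
  \<comment> \<open>Since \<open>p\<close> divides the product of \<open>g j\<close> and
    \<open>x k\<close>, a factor \<open>p\<close> comes out of the whole product; modulo
    \<open>p\<close>, what remains depends on \<open>g j\<close> in the term with \<open>y\<close>
    only through \<open>x j\<close>.\<close>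
  have old: "(int p)\<^sup>2 dvd dot n (g j) (f y) \<longleftrightarrow> [dot n (x j) y = c j] (mod int p)"
    if "j < k" for j y
  proof -
    have gx: "[g j i = x j i] (mod int p)" if "i < n" for i
      using g[OF \<open>j < k\<close>] that by (simp add: lifts_def)
    have "[dot n (g j) (x k) = dot n (x j) (x k)] (mod int p)"
      by (intro dot_cong gx cong_refl)
    then have dvd: "int p dvd dot n (g j) (x k)"
      using orth[of j] that by (simp add: cong_dvd_iff)
    have "[dot n (g j) (f y) = dot n (g j) (\<lambda>i. x k i + int p * y i)] (mod (int p)\<^sup>2)"
      by (intro dot_cong f_cong cong_refl)
    also have "dot n (g j) (\<lambda>i. x k i + int p * y i)
        = int p * (dot n (g j) (x k) div int p + dot n (g j) y)"
      using dvd by (simp add: dot_add_right dot_scale_right distrib_left)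
    finally have "(int p)\<^sup>2 dvd dot n (g j) (f y) \<longleftrightarrow>
        int p dvd dot n (g j) (x k) div int p + dot n (g j) y"
      by (rule square_dvd_iff[OF p0])
    also have "\<dots> \<longleftrightarrow> int p dvd dot n (g j) (x k) div int p + dot n (x j) y"
      by (intro cong_dvd_iff cong_add dot_cong gx cong_refl)
    also have "\<dots> \<longleftrightarrow> [dot n (x j) y = c j] (mod int p)"
      using that by (simp add: c_def cong_iff_dvd_diff add.commute)
    finally show ?thesis .
  qed
  \<comment> \<open>The quadratic term of the product of \<open>x k + p y\<close> with itself has
    the factor \<open>p^2\<close>, so the condition becomes linear in \<open>y\<close>:
    \<open>p\<close> must divide \<open>E + 2 * D\<close>.\<close>
  have new: "(int p)\<^sup>2 dvd dot n (f y) (f y) \<longleftrightarrow> (e = 1 \<longrightarrow> [dot n (x k) y = c k] (mod int p))" for y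
  proof -
    define D where "D = dot n (x k) y"
    define E where "E = dot n (x k) (x k) div int p"
    have E: "dot n (x k) (x k) = int p * E"
      using orth[of k] by (simp add: E_def)
    have "[dot n (f y) (f y) = dot n (\<lambda>i. x k i + int p * y i) (\<lambda>i. x k i + int p * y i)] (mod (int p)\<^sup>2)"
      by (intro dot_cong f_cong)
    also have "dot n (\<lambda>i. x k i + int p * y i) (\<lambda>i. x k i + int p * y i)
        = int p * (E + 2 * D + int p * dot n y y)"
      by (simp add: dot_add_right dot_scale_right dot_add_left dot_scale_left E
        dot_commute[of n y "x k"] flip: D_def) (simp add: algebra_simps)
    finally have "(int p)\<^sup>2 dvd dot n (f y) (f y) \<longleftrightarrow> int p dvd (E + 2 * D) + int p * dot n y y"
      by (rule square_dvd_iff[OF p0])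
    also have "\<dots> \<longleftrightarrow> int p dvd E + 2 * D"
      by (rule dvd_add_left_iff) simp
    also have "\<dots> \<longleftrightarrow> (e = 1 \<longrightarrow> [D = c k] (mod int p))"
    proof (cases "p = 2")
      case True
      \<comment> \<open>Divisibility of the self-product by 4 makes \<open>E\<close> even, so
        \<open>E + 2 * D\<close> is even for every \<open>y\<close>.\<close>
      with even E have "4 dvd 2 * E" by simp
      then have "2 dvd E" by presburger
      with True show ?thesis by (simp add: e_def)
    next
      case False
      then have "odd p" using p primes_dvd_imp_eq two_is_prime_nat by blast
      then obtain r where r: "p = 2 * r + 1" by (auto elim: oddE)
      have v: "(int p + 1) div 2 = int r + 1" by (simp add: r)
      have coprime: "coprime (int p) 2"
        using \<open>odd p\<close> by simp
      \<comment> \<open>Adding the multiple \<open>p * E\<close> makes the expression even, because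
        \<open>p + 1 = 2 * (r + 1)\<close>; the factor 2 then cancels modulo the odd
        \<open>p\<close>.\<close>
      have "int p dvd E + 2 * D \<longleftrightarrow> int p dvd (E + 2 * D) + int p * E"
        by (rule sym, rule dvd_add_left_iff) simp
      also have "(E + 2 * D) + int p * E = 2 * (D + E * (int r + 1))"
        by (simp add: r algebra_simps)
      also have "int p dvd \<dots> \<longleftrightarrow> int p dvd D + E * (int r + 1)"
        by (rule coprime_dvd_mult_right_iff[OF coprime])
      also have "\<dots> \<longleftrightarrow> [D = c k] (mod int p)"
        by (simp add: c_def cong_iff_dvd_diff v flip: E_def)
      finally show ?thesis
        using False by (simp add: e_def)
    qed
    finally show ?thesis by (simp add: D_def)
  qed
  have bij: "bij_betw f (words p n) (lifts p n (x k))"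
    unfolding f_def by (rule bij_betw_lifts[OF p0])
  have SolH: "y \<in> Sol \<longleftrightarrow> y \<in> words p n \<and> f y \<in> H" for y
  proof -
    have "(\<forall>j<k + e. [dot n (x j) y = c j] (mod int p)) \<longleftrightarrow>
        (\<forall>j<k. [dot n (x j) y = c j] (mod int p)) \<and> (e = 1 \<longrightarrow> [dot n (x k) y = c k] (mod int p))"
      by (auto simp: e_def less_Suc_eq)
    then show ?thesis
      using bij by (auto simp: Sol_def H_def old new bij_betw_def)
  qed
  have "f ` Sol = H"
  proof (intro equalityI subsetI)
    show "h \<in> H" if "h \<in> f ` Sol" for h
      using that SolH by auto
    show "h \<in> f ` Sol" if h: "h \<in> H" for h
    proof -
      have "h \<in> f ` words p n"
        using h bij by (simp add: H_def bij_betw_def)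
      then show ?thesis using h SolH by auto
    qed
  qed
  moreover have "inj_on f Sol"
    using bij unfolding bij_betw_def Sol_def by (auto intro: inj_on_subset)
  ultimately have "card H = card Sol"
    using card_image by blast
  moreover have "lin_indep_mod p n (k + e) x"
    using li lin_indep_mod_Suc[OF li] by (auto simp: e_def)
  then have "card Sol * p ^ (k + e) = p ^ n"
    unfolding Sol_def by (rule card_solutions[OF p])
  ultimately show ?thesis
    by (simp add: H_def e_def)
qed

text \<open>The entries are chosen successively, and the number of admissible next entries does not
  depend on the earlier choices. The summand for \<open>j\<close> is the number of independent
  equations on entry \<open>j\<close>.\<close>

lemma card_lift_tuples:
  assumes p: "prime p" and "lin_indep_mod p n k x"
    and "\<And>i j. i < k \<Longrightarrow> j < k \<Longrightarrow> int p dvd dot n (x i) (x j)"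
    and "\<And>j. p = 2 \<Longrightarrow> j < k \<Longrightarrow> 4 dvd dot n (x j) (x j)"
  shows "card (lift_tuples p n k x) * p ^ (\<Sum>j<k. j + (if p = 2 then 0 else 1)) = p ^ (n * k)"
  using assms(2-)
proof (induction k)
  case 0
  have "lift_tuples p n 0 x = {\<lambda>_. undefined}"
    by (auto simp: lift_tuples_def)
  then show ?case by simp
next
  case (Suc k)
  let ?T = "lift_tuples p n k x" and ?e = "if p = 2 then 0 else 1 :: nat"
  define H where "H g = {h \<in> lifts p n (x k).
    (\<forall>j<k. (int p)\<^sup>2 dvd dot n (g j) h) \<and> (int p)\<^sup>2 dvd dot n h h}" for g
  \<comment> \<open>A tuple of length \<open>Suc k\<close> is a tuple of length \<open>k\<close>
    together with an admissible last entry.\<close>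
  have "bij_betw (\<lambda>(g, h). g(k := h)) (SIGMA g:?T. H g) (lift_tuples p n (Suc k) x)"
  proof (rule bij_betw_byWitness[where f' = "\<lambda>g. (restrict g {..<k}, g k)"])
    show "\<forall>gh\<in>SIGMA g:?T. H g. (\<lambda>g. (restrict g {..<k}, g k)) ((\<lambda>(g, h). g(k := h)) gh) = gh"
      by (auto simp: lift_tuples_def PiE_def extensional_def restrict_def fun_eq_iff)
    show "\<forall>g\<in>lift_tuples p n (Suc k) x. (\<lambda>(g, h). g(k := h)) (restrict g {..<k}, g k) = g"
      by (auto simp: lift_tuples_def PiE_def extensional_def restrict_def fun_eq_iff)
    show "(\<lambda>(g, h). g(k := h)) ` (SIGMA g:?T. H g) \<subseteq> lift_tuples p n (Suc k) x"
    proof clarify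
      fix g h assume g: "g \<in> ?T" and h: "h \<in> H g"
      have "g(k := h) \<in> (\<Pi>\<^sub>E j\<in>{..<Suc k}. lifts p n (x j))"
        using g h by (auto simp: lift_tuples_def H_def PiE_def extensional_def Pi_def less_Suc_eq)
      moreover have "(int p)\<^sup>2 dvd dot n ((g(k := h)) i) ((g(k := h)) j)" if "i < Suc k" "j < Suc k" for i j
        using that g h
        by (auto simp: lift_tuples_def H_def less_Suc_eq dot_commute[of n h "g j"])
      ultimately show "g(k := h) \<in> lift_tuples p n (Suc k) x"
        unfolding lift_tuples_def by blast
    qed
    show "(\<lambda>g. (restrict g {..<k}, g k)) ` lift_tuples p n (Suc k) x \<subseteq> (SIGMA g:?T. H g)"
      by (auto simp: lift_tuples_def H_def)
  qed
  then have "card (lift_tuples p n (Suc k) x) = card (SIGMA g:?T. H g)"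
    by (simp add: bij_betw_same_card)
  also have "\<dots> = (\<Sum>g\<in>?T. card (H g))"
    using finite_lift_tuples finite_lifts by (intro card_SigmaI) (auto simp: H_def)
  finally have "card (lift_tuples p n (Suc k) x) * p ^ (k + ?e) = (\<Sum>g\<in>?T. card (H g) * p ^ (k + ?e))"
    by (simp only: sum_distrib_right)
  also have "\<dots> = (\<Sum>g\<in>?T. p ^ n)"
  proof (rule sum.cong[OF refl])
    fix g assume g: "g \<in> ?T"
    show "card (H g) * p ^ (k + ?e) = p ^ n"
      unfolding H_def
    proof (rule card_lift_extensions[OF p Suc.prems(1)])
      show "g j \<in> lifts p n (x j)" if "j < k" for j
        using g that by (auto simp: lift_tuples_def)
      show "int p dvd dot n (x j) (x k)" if "j \<le> k" for j
        using that by (intro Suc.prems(2)) auto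
      show "4 dvd dot n (x k) (x k)" if "p = 2"
        using that by (intro Suc.prems(3)) auto
    qed
  qed
  also have "\<dots> = card ?T * p ^ n"
    by simp
  finally have step: "card (lift_tuples p n (Suc k) x) * p ^ (k + ?e) = card ?T * p ^ n" .
  have IH: "card ?T * p ^ (\<Sum>j<k. j + ?e) = p ^ (n * k)"
    by (rule Suc.IH[OF lin_indep_mod_Suc[OF Suc.prems(1)]]) (simp_all add: Suc.prems)
  have "card (lift_tuples p n (Suc k) x) * p ^ (\<Sum>j<Suc k. j + ?e)
      = (card (lift_tuples p n (Suc k) x) * p ^ (k + ?e)) * p ^ (\<Sum>j<k. j + ?e)"
    by (simp add: power_add mult_ac)
  also have "\<dots> = (card ?T * p ^ (\<Sum>j<k. j + ?e)) * p ^ n"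
    unfolding step by (simp add: mult_ac)
  also have "\<dots> = p ^ (n * Suc k)"
    unfolding IH by (simp add: power_add mult_ac)
  finally show ?case .
qed

section \<open>Codes with given residue and torsion\<close>

text \<open>For a code \<open>C2\<close> this is the submodule generated by the first
  \<open>k\<close> entries of \<open>g\<close> and \<open>p C2\<close>.\<close>

definition lift_code ::
    "nat \<Rightarrow> nat \<Rightarrow> nat \<Rightarrow> (nat \<Rightarrow> int) set \<Rightarrow> (nat \<Rightarrow> nat \<Rightarrow> int) \<Rightarrow> (nat \<Rightarrow> int) set"
  where "lift_code p n k C2 g = {w \<in> words (p ^ 2) n. \<exists>a. \<exists>c\<in>C2. \<forall>i<n.
    [w i = (\<Sum>j<k. a j * g j i) + int p * c i] (mod (int p)\<^sup>2)}"

definition self_orthogonal_lifts ::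
    "nat \<Rightarrow> nat \<Rightarrow> (nat \<Rightarrow> int) set \<Rightarrow> (nat \<Rightarrow> int) set \<Rightarrow> (nat \<Rightarrow> int) set set"
  where "self_orthogonal_lifts p n C1 C2 = {C. is_code (p ^ 2) n C \<and> self_orthogonal (p ^ 2) n C \<and>
    residue_code p n C = C1 \<and> torsion_code p n C = C2}"

lemma code_lincomb_mem:
  assumes m: "m > 1" and C: "is_code m n C" and xy: "x \<in> C" "y \<in> C" and w: "w \<in> words m n"
    and "\<And>i. i < n \<Longrightarrow> [a * x i + b * y i = w i] (mod int m)"
  shows "w \<in> C"
proof -
  have "reduction m n (\<lambda>i. a * x i + b * y i) = w"
    using assms by (intro reduction_eqI) auto
  with code_lincomb_closed[OF m C xy] show ?thesis by metis
qed

locale code_pair =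
  fixes p n k :: nat and C1 C2 :: "(nat \<Rightarrow> int) set" and x :: "nat \<Rightarrow> nat \<Rightarrow> int"
  assumes p: "prime p" and C1: "is_code p n C1" and C2: "is_code p n C2"
    and sub: "C1 \<subseteq> C2" and dual: "C2 \<subseteq> dual_code p n C1"
    and xC: "\<And>j. j < k \<Longrightarrow> x j \<in> C1" and indep: "lin_indep_mod p n k x"
    and span: "\<And>w. w \<in> C1 \<Longrightarrow> \<exists>a. \<forall>i<n. [w i = (\<Sum>j<k. a j * x j i)] (mod int p)"
begin

lemma p1: "p > 1" and p0: "p > 0" and q0: "p ^ 2 > 0"
  using prime_gt_1_nat[OF p] by auto

lemma q1: "p ^ 2 > 1"
  using p1 by (rule one_less_power) simp

lemma C1_words: "C1 \<subseteq> words p n" and C2_words: "C2 \<subseteq> words p n"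
  by (rule code_subset_words[OF p1 C1], rule code_subset_words[OF p1 C2])

lemma C1_dot_C2: "y \<in> C1 \<Longrightarrow> c \<in> C2 \<Longrightarrow> int p dvd dot n y c"
  using dual dual_code_eq[OF p1] by (auto simp: dot_commute[of n y c])

lemma embedding_in_words: "embedding p n c \<in> words (p ^ 2) n"
  unfolding embedding_eq by (rule reduction_in_words[OF q0])

lemma embedding_cong: "i < n \<Longrightarrow> [embedding p n c i = int p * c i] (mod (int p)\<^sup>2)"
  unfolding embedding_eq by (rule reduction_square_cong)

lemma embedding_in_code_iff:
  assumes "c \<in> words p n" "torsion_code p n C = C2"
  shows "embedding p n c \<in> C \<longleftrightarrow> c \<in> C2"
  using assms by (auto simp: torsion_code_def word_module_simps(1)[OF p1])

lemma zero_in_C2: "reduction p n (\<lambda>_. 0) \<in> C2"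
  using code_sum_closed[OF p1 C2, of 0] by simp

section \<open>The code generated by a tuple of orthogonal lifts and \<open>p C2\<close>\<close>

context
  fixes g assumes g: "g \<in> lift_tuples p n k x"
begin

lemma g_lifts: "j < k \<Longrightarrow> g j \<in> lifts p n (x j)"
  using g by (auto simp: lift_tuples_def)

lemma g_words: "j < k \<Longrightarrow> g j \<in> words (p ^ 2) n"
  using g_lifts by (simp add: lifts_def)

lemma g_cong: "j < k \<Longrightarrow> i < n \<Longrightarrow> [g j i = x j i] (mod int p)"
  using g_lifts by (simp add: lifts_def)

lemma g_dot: "i < k \<Longrightarrow> j < k \<Longrightarrow> (int p)\<^sup>2 dvd dot n (g i) (g j)"
  using g by (simp add: lift_tuples_def)

lemma g_sum_cong: "i < n \<Longrightarrow> [(\<Sum>j<k. a j * g j i) = (\<Sum>j<k. a j * x j i)] (mod int p)"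
  by (intro cong_sum cong_mult g_cong cong_refl) auto

text \<open>Modulo \<open>p\<close> the part from \<open>p C2\<close> vanishes and \<open>g\<close>
  becomes \<open>x\<close>.\<close>

lemma lift_code_mod:
  assumes "i < n" "\<And>i. i < n \<Longrightarrow> [w i = (\<Sum>j<k. a j * g j i) + int p * c i] (mod (int p)\<^sup>2)"
  shows "[w i = (\<Sum>j<k. a j * x j i)] (mod int p)"
proof -
  have "[w i = (\<Sum>j<k. a j * g j i) + int p * c i] (mod int p)"
    by (rule cong_square_imp[OF assms(2)[OF assms(1)]])
  also have "[(\<Sum>j<k. a j * g j i) + int p * c i = (\<Sum>j<k. a j * x j i) + 0] (mod int p)"
    by (intro cong_add g_sum_cong assms) (simp add: cong_0_iff)
  finally show ?thesis by simp
qed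

lemma lift_codeI:
  assumes "w \<in> words (p ^ 2) n" "c \<in> C2"
    "\<And>i. i < n \<Longrightarrow> [w i = (\<Sum>j<k. a j * g j i) + int p * c i] (mod (int p)\<^sup>2)"
  shows "w \<in> lift_code p n k C2 g"
  using assms unfolding lift_code_def by blast

lemma embedding_in_lift_code:
  assumes "c \<in> C2"
  shows "embedding p n c \<in> lift_code p n k C2 g"
  by (rule lift_codeI[OF embedding_in_words assms, where a = "\<lambda>_. 0"])
    (simp add: embedding_cong)

lemma g_in_lift_code:
  assumes "l < k"
  shows "g l \<in> lift_code p n k C2 g"
proof (rule lift_codeI[OF g_words[OF assms] zero_in_C2, where a = "\<lambda>j. if j = l then 1 else 0"])
  fix i assume "i < n"
  have "(\<Sum>j<k. (if j = l then 1 else 0) * g j i) = (\<Sum>j<k. if j = l then g j i else 0)"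
    by (intro sum.cong) auto
  with assms \<open>i < n\<close> show "[g l i = (\<Sum>j<k. (if j = l then 1 else 0) * g j i)
      + int p * reduction p n (\<lambda>_. 0) i] (mod (int p)\<^sup>2)"
    by (simp add: reduction_def)
qed

lemma is_code_lift_code: "is_code (p ^ 2) n (lift_code p n k C2 g)"
  unfolding is_code_iff[OF q1]
proof (intro conjI ballI allI)
  show "lift_code p n k C2 g \<subseteq> words (p ^ 2) n"
    by (auto simp: lift_code_def)
  show "lift_code p n k C2 g \<noteq> {}"
    using embedding_in_lift_code[OF zero_in_C2] by blast
next
  fix u v and r s :: int
  assume uv: "u \<in> lift_code p n k C2 g" "v \<in> lift_code p n k C2 g"
  obtain a c where c: "c \<in> C2"
    and u: "\<And>i. i < n \<Longrightarrow> [u i = (\<Sum>j<k. a j * g j i) + int p * c i] (mod (int p)\<^sup>2)"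
    using uv(1) unfolding lift_code_def by blast
  obtain b d where d: "d \<in> C2"
    and v: "\<And>i. i < n \<Longrightarrow> [v i = (\<Sum>j<k. b j * g j i) + int p * d i] (mod (int p)\<^sup>2)"
    using uv(2) unfolding lift_code_def by blast
  \<comment> \<open>The part from \<open>C2\<close> matters only modulo \<open>p\<close>, as it is
    multiplied by \<open>p\<close>; hence it may be reduced to a word of \<open>C2\<close>.\<close>
  define e where "e = reduction p n (\<lambda>i. r * c i + s * d i)"
  have e: "e \<in> C2"
    unfolding e_def by (rule code_lincomb_closed[OF p1 C2 c d])
  show "reduction (p ^ 2) n (\<lambda>i. r * u i + s * v i) \<in> lift_code p n k C2 g"
  proof (rule lift_codeI[OF reduction_in_words[OF q0] e, where a = "\<lambda>j. r * a j + s * b j"])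
    fix i assume i: "i < n"
    have "[reduction (p ^ 2) n (\<lambda>i. r * u i + s * v i) i = r * u i + s * v i] (mod (int p)\<^sup>2)"
      by (rule reduction_square_cong[OF i])
    also have "[r * u i + s * v i = r * ((\<Sum>j<k. a j * g j i) + int p * c i)
        + s * ((\<Sum>j<k. b j * g j i) + int p * d i)] (mod (int p)\<^sup>2)"
      by (intro cong_add cong_mult cong_refl u v i)
    also have "r * ((\<Sum>j<k. a j * g j i) + int p * c i) + s * ((\<Sum>j<k. b j * g j i) + int p * d i)
        = (\<Sum>j<k. (r * a j + s * b j) * g j i) + int p * (r * c i + s * d i)"
      by (simp add: algebra_simps sum.distrib sum_distrib_left)
    also have "[\<dots> = (\<Sum>j<k. (r * a j + s * b j) * g j i) + int p * e i] (mod (int p)\<^sup>2)"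
      unfolding e_def by (intro cong_add cong_refl cong_scale_prime cong_sym[OF reduction_cong[OF i]])
    finally show "[reduction (p ^ 2) n (\<lambda>i. r * u i + s * v i) i
        = (\<Sum>j<k. (r * a j + s * b j) * g j i) + int p * e i] (mod (int p)\<^sup>2)" .
  qed
qed

text \<open>Three kinds of products of generators occur: entries of \<open>g\<close> are orthogonal
  by the choice of \<open>g\<close>; an entry of \<open>g\<close> with \<open>p c\<close> gives
  \<open>p\<close> times a multiple of \<open>p\<close>, as \<open>C2\<close> is orthogonal to
  \<open>C1\<close>; two words of \<open>p C2\<close> give a multiple of \<open>p^2\<close>.\<close>

lemma self_orthogonal_lift_code: "self_orthogonal (p ^ 2) n (lift_code p n k C2 g)"
  unfolding self_orthogonal_iff[OF q1 is_code_lift_code]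
proof (intro ballI)
  fix u v assume uv: "u \<in> lift_code p n k C2 g" "v \<in> lift_code p n k C2 g"
  obtain a c where c: "c \<in> C2"
    and u: "\<And>i. i < n \<Longrightarrow> [u i = (\<Sum>j<k. a j * g j i) + int p * c i] (mod (int p)\<^sup>2)"
    using uv(1) unfolding lift_code_def by blast
  obtain b d where d: "d \<in> C2"
    and v: "\<And>i. i < n \<Longrightarrow> [v i = (\<Sum>j<k. b j * g j i) + int p * d i] (mod (int p)\<^sup>2)"
    using uv(2) unfolding lift_code_def by blast
  define G where "G a i = (\<Sum>j<k. a j * g j i)" for a :: "nat \<Rightarrow> int" and i
  have dot_G: "dot n z (G a) = (\<Sum>j<k. a j * dot n z (g j))" for z a
    unfolding G_def by (simp add: dot_sum_right dot_scale_right)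
  have Gc: "(int p)\<^sup>2 dvd int p * dot n c (G a)" if "c \<in> C2" for c a
  proof -
    have "int p dvd dot n c (g j)" if "j < k" for j
    proof -
      have "[dot n c (g j) = dot n c (x j)] (mod int p)"
        by (intro dot_cong cong_refl g_cong that)
      with C1_dot_C2[OF xC[OF that] \<open>c \<in> C2\<close>] show ?thesis
        by (simp add: cong_dvd_iff dot_commute[of n c "x j"])
    qed
    then have "int p dvd dot n c (G a)"
      unfolding dot_G by (intro dvd_sum) simp
    then show ?thesis
      by (simp add: power2_eq_square)
  qed
  have GG: "(int p)\<^sup>2 dvd dot n (G a) (G b)"
  proof -
    have "(int p)\<^sup>2 dvd dot n (g j) (G a)" if "j < k" for j
      unfolding dot_G using that by (intro dvd_sum dvd_mult g_dot) auto
    then show ?thesis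
      unfolding dot_G[of "G a"] by (intro dvd_sum dvd_mult) (simp add: dot_commute[of n "G a"])
  qed
  have "[dot n u v = dot n (\<lambda>i. G a i + int p * c i) (\<lambda>i. G b i + int p * d i)] (mod (int p)\<^sup>2)"
    unfolding G_def by (intro dot_cong u v)
  also have "dot n (\<lambda>i. G a i + int p * c i) (\<lambda>i. G b i + int p * d i)
      = dot n (G a) (G b) + int p * dot n d (G a) + int p * dot n c (G b) + (int p)\<^sup>2 * dot n c d"
    by (simp add: dot_add_left dot_add_right dot_scale_left dot_scale_right
        dot_commute[of n "G a" d] power2_eq_square algebra_simps)
  finally have "(int p)\<^sup>2 dvd dot n u v \<longleftrightarrow>
      (int p)\<^sup>2 dvd dot n (G a) (G b) + int p * dot n d (G a) + int p * dot n c (G b) + (int p)\<^sup>2 * dot n c d"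
    by (rule cong_dvd_iff)
  moreover have "(int p)\<^sup>2 dvd dot n (G a) (G b) + int p * dot n d (G a) + int p * dot n c (G b) + (int p)\<^sup>2 * dot n c d"
    by (intro dvd_add GG Gc c d) simp
  ultimately show "int (p ^ 2) dvd dot n u v" by simp
qed

lemma residue_lift_code: "residue_code p n (lift_code p n k C2 g) = C1"
  unfolding residue_code_def
proof (intro equalityI subsetI)
  fix v assume "v \<in> reduction p n ` lift_code p n k C2 g"
  then obtain w where v: "v = reduction p n w" and "w \<in> lift_code p n k C2 g" by blast
  then obtain a c where w: "\<And>i. i < n \<Longrightarrow> [w i = (\<Sum>j<k. a j * g j i) + int p * c i] (mod (int p)\<^sup>2)"
    unfolding lift_code_def by blast
  have "v = reduction p n (\<lambda>i. \<Sum>j<k. a j * x j i)"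
    unfolding v
  proof (rule reduction_eqI[OF p0 reduction_in_words[OF p0]])
    fix i assume i: "i < n"
    have "[w i = (\<Sum>j<k. a j * x j i)] (mod int p)"
      by (rule lift_code_mod[OF i w])
    then show "[w i = reduction p n (\<lambda>i. \<Sum>j<k. a j * x j i) i] (mod int p)"
      by (rule cong_trans) (rule cong_sym[OF reduction_cong[OF i]])
  qed
  then show "v \<in> C1"
    using code_sum_closed[OF p1 C1 xC] by simp
next
  fix v assume v: "v \<in> C1"
  then obtain a where a: "\<And>i. i < n \<Longrightarrow> [v i = (\<Sum>j<k. a j * x j i)] (mod int p)"
    using span by blast
  \<comment> \<open>The coefficients of \<open>v\<close> on the basis \<open>x\<close>, applied to
    \<open>g\<close>, give a preimage of \<open>v\<close>.\<close>
  define w where "w = reduction (p ^ 2) n (\<lambda>i. \<Sum>j<k. a j * g j i)"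
  have w: "[w i = (\<Sum>j<k. a j * g j i)] (mod (int p)\<^sup>2)" if "i < n" for i
    unfolding w_def by (rule reduction_square_cong[OF that])
  have "w \<in> lift_code p n k C2 g"
    using is_code_lift_code g_in_lift_code unfolding w_def by (rule code_sum_closed[OF q1])
  moreover have "reduction p n w = v"
  proof (rule reduction_eqI[OF p0])
    show "v \<in> words p n" using v C1_words by blast
    fix i assume i: "i < n"
    show "[w i = v i] (mod int p)"
      using cong_trans[OF cong_trans[OF cong_square_imp[OF w[OF i]] g_sum_cong[OF i]] cong_sym[OF a[OF i]]] .
  qed
  ultimately show "v \<in> reduction p n ` lift_code p n k C2 g" by blast
qed

text \<open>If \<open>p v\<close> equals a combination of \<open>g\<close> plus \<open>p c\<close>,
  reduction modulo \<open>p\<close> and independence of \<open>x\<close> make all coefficients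
  multiples of \<open>p\<close>. Dividing by \<open>p\<close> puts \<open>v\<close> in
  \<open>C1 + C2\<close>, which is \<open>C2\<close>.\<close>

lemma torsion_lift_code: "torsion_code p n (lift_code p n k C2 g) = C2"
proof (intro equalityI subsetI)
  fix v assume "v \<in> C2"
  then show "v \<in> torsion_code p n (lift_code p n k C2 g)"
    using C2_words embedding_in_lift_code by (auto simp: torsion_code_def word_module_simps(1)[OF p1])
next
  fix v assume "v \<in> torsion_code p n (lift_code p n k C2 g)"
  then have v: "v \<in> words p n" and "embedding p n v \<in> lift_code p n k C2 g"
    by (auto simp: torsion_code_def word_module_simps(1)[OF p1])
  then obtain a c where c: "c \<in> C2"
    and ev: "\<And>i. i < n \<Longrightarrow> [embedding p n v i = (\<Sum>j<k. a j * g j i) + int p * c i] (mod (int p)\<^sup>2)"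
    unfolding lift_code_def by blast
  have "int p dvd (\<Sum>j<k. a j * x j i)" if "i < n" for i
  proof -
    have "[int p * v i = (\<Sum>j<k. a j * x j i)] (mod int p)"
      using cong_trans[OF cong_sym[OF cong_square_imp[OF embedding_cong[OF that]]] lift_code_mod[OF that ev]] .
    then show ?thesis
      by (metis cong_dvd_iff dvd_triv_left)
  qed
  then have "int p dvd a j" if "j < k" for j
    using indep that unfolding lin_indep_mod_def by blast
  define b where "b j = a j div int p" for j
  have ab: "a j = int p * b j" if "j < k" for j
    using \<open>\<And>j. j < k \<Longrightarrow> int p dvd a j\<close> that by (simp add: b_def)
  define y where "y = reduction p n (\<lambda>i. \<Sum>j<k. b j * x j i)"
  have "y \<in> C2"
    using code_sum_closed[OF p1 C1 xC] sub by (auto simp: y_def)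
  then show "v \<in> C2"
  proof (rule code_lincomb_mem[OF p1 C2 _ c v, where a = 1 and b = 1])
    fix i assume i: "i < n"
    have "[int p * v i = (\<Sum>j<k. a j * g j i) + int p * c i] (mod (int p)\<^sup>2)"
      using cong_trans[OF cong_sym[OF embedding_cong[OF i]] ev[OF i]] .
    also have "(\<Sum>j<k. a j * g j i) + int p * c i = int p * ((\<Sum>j<k. b j * g j i) + c i)"
      by (simp add: ab sum_distrib_left distrib_left mult.assoc)
    finally have "[v i = (\<Sum>j<k. b j * g j i) + c i] (mod int p)"
      using p0 by (simp add: cong_iff_dvd_diff power2_eq_square flip: right_diff_distrib)
    also have "[(\<Sum>j<k. b j * g j i) + c i = (\<Sum>j<k. b j * x j i) + c i] (mod int p)"
      by (intro cong_add cong_refl g_sum_cong i)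
    also have "[(\<Sum>j<k. b j * x j i) + c i = y i + c i] (mod int p)"
      unfolding y_def by (intro cong_add cong_refl cong_sym[OF reduction_cong[OF i]])
    finally show "[1 * y i + 1 * c i = v i] (mod int p)"
      by (simp add: cong_sym)
  qed
qed

lemma lift_code_in_self_orthogonal_lifts:
  "lift_code p n k C2 g \<in> self_orthogonal_lifts p n C1 C2"
  unfolding self_orthogonal_lifts_def
  using is_code_lift_code self_orthogonal_lift_code residue_lift_code torsion_lift_code by simp

text \<open>Such a \<open>C\<close> contains \<open>g\<close> and \<open>p C2\<close>. Conversely,
  subtracting from a word of \<open>C\<close> the combination of \<open>g\<close> with the same
  residue leaves a multiple of \<open>p\<close> in \<open>C\<close>, that is, the embedding of a
  word of the torsion code.\<close>

lemma lift_code_unique: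
  assumes C: "C \<in> self_orthogonal_lifts p n C1 C2" and gC: "\<And>j. j < k \<Longrightarrow> g j \<in> C"
  shows "C = lift_code p n k C2 g"
proof -
  have code: "is_code (p ^ 2) n C" and res: "residue_code p n C = C1" and tor: "torsion_code p n C = C2"
    using C by (auto simp: self_orthogonal_lifts_def)
  define G where "G a = reduction (p ^ 2) n (\<lambda>i. \<Sum>j<k. a j * g j i)" for a
  have GC: "G a \<in> C" for a
    unfolding G_def by (rule code_sum_closed[OF q1 code gC])
  have G: "[G a i = (\<Sum>j<k. a j * g j i)] (mod (int p)\<^sup>2)" if "i < n" for a i
    unfolding G_def by (rule reduction_square_cong[OF that])
  show ?thesis
  proof (intro equalityI subsetI)
    fix w assume "w \<in> lift_code p n k C2 g"
    then obtain a c where w: "w \<in> words (p ^ 2) n" "c \<in> C2"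
      "\<And>i. i < n \<Longrightarrow> [w i = (\<Sum>j<k. a j * g j i) + int p * c i] (mod (int p)\<^sup>2)"
      unfolding lift_code_def by blast
    have "embedding p n c \<in> C"
      using embedding_in_code_iff[OF _ tor] w(2) C2_words by blast
    then show "w \<in> C"
    proof (rule code_lincomb_mem[OF q1 code GC _ w(1), where a = 1 and b = 1])
      fix i assume i: "i < n"
      have "[1 * G a i + 1 * embedding p n c i = 1 * (\<Sum>j<k. a j * g j i) + 1 * (int p * c i)] (mod (int p)\<^sup>2)"
        by (intro cong_add cong_mult cong_refl G embedding_cong i)
      also have "[1 * (\<Sum>j<k. a j * g j i) + 1 * (int p * c i) = w i] (mod (int p)\<^sup>2)"
        using cong_sym[OF w(3)[OF i]] by simp
      finally show "[1 * G a i + 1 * embedding p n c i = w i] (mod int (p ^ 2))"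
        by simp
    qed
  next
    fix w assume wC: "w \<in> C"
    then have w: "w \<in> words (p ^ 2) n"
      using code_subset_words[OF q1 code] by blast
    have "reduction p n w \<in> C1"
      using wC res by (auto simp: residue_code_def)
    then obtain a where a: "\<And>i. i < n \<Longrightarrow> [reduction p n w i = (\<Sum>j<k. a j * x j i)] (mod int p)"
      using span by blast
    define d where "d i = w i - (\<Sum>j<k. a j * g j i)" for i
    have d: "int p dvd d i" if "i < n" for i
    proof -
      have "[w i = (\<Sum>j<k. a j * g j i)] (mod int p)"
        using cong_trans[OF cong_trans[OF cong_sym[OF reduction_cong[OF that]] a[OF that]]
            cong_sym[OF g_sum_cong[OF that]]] .
      then show ?thesis by (simp add: d_def cong_iff_dvd_diff)
    qed
    define c where "c = reduction p n (\<lambda>i. d i div int p)"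
    have ec: "[embedding p n c i = d i] (mod (int p)\<^sup>2)" if "i < n" for i
    proof -
      have "[embedding p n c i = int p * c i] (mod (int p)\<^sup>2)"
        by (rule embedding_cong[OF that])
      also have "[int p * c i = int p * (d i div int p)] (mod (int p)\<^sup>2)"
        unfolding c_def by (intro cong_scale_prime reduction_cong that)
      finally show ?thesis using d[OF that] by simp
    qed
    have "embedding p n c \<in> C"
    proof (rule code_lincomb_mem[OF q1 code wC GC embedding_in_words, where a = 1 and b = "- 1"])
      fix i assume i: "i < n"
      have "[1 * w i + - 1 * G a i = 1 * w i + - 1 * (\<Sum>j<k. a j * g j i)] (mod (int p)\<^sup>2)"
        by (intro cong_add cong_mult cong_refl G i)
      also have "[1 * w i + - 1 * (\<Sum>j<k. a j * g j i) = embedding p n c i] (mod (int p)\<^sup>2)"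
        using cong_sym[OF ec[OF i]] by (simp add: d_def)
      finally show "[1 * w i + - 1 * G a i = embedding p n c i] (mod int (p ^ 2))"
        by simp
    qed
    then have c: "c \<in> C2"
      using embedding_in_code_iff[OF _ tor] reduction_in_words[OF p0] unfolding c_def by blast
    show "w \<in> lift_code p n k C2 g"
    proof (rule lift_codeI[OF w c])
      fix i assume i: "i < n"
      have "[(\<Sum>j<k. a j * g j i) + d i = (\<Sum>j<k. a j * g j i) + int p * c i] (mod (int p)\<^sup>2)"
        by (intro cong_add cong_refl cong_trans[OF cong_sym[OF ec[OF i]] embedding_cong[OF i]])
      then show "[w i = (\<Sum>j<k. a j * g j i) + int p * c i] (mod (int p)\<^sup>2)"
        by (simp add: d_def)
    qed
  qed
qed

end

text \<open>The lifts of \<open>y\<close> inside \<open>C\<close> form a coset of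
  \<open>p C2\<close>.\<close>

lemma card_lifts_in_code:
  assumes C: "C \<in> self_orthogonal_lifts p n C1 C2" and y: "y \<in> C1"
  shows "card (lifts p n y \<inter> C) = card C2"
proof -
  have code: "is_code (p ^ 2) n C" and res: "residue_code p n C = C1" and tor: "torsion_code p n C = C2"
    using C by (auto simp: self_orthogonal_lifts_def)
  obtain h0 where h0: "h0 \<in> C" "reduction p n h0 = y"
    using y res by (auto simp: residue_code_def)
  have "[y i = h0 i] (mod int p)" if "i < n" for i
    using reduction_cong[OF that] h0(2) by metis
  \<comment> \<open>Relative to \<open>h0\<close>, which lies in \<open>C\<close>, a lift
    \<open>h0 + p c\<close> belongs to \<open>C\<close> exactly if \<open>p c\<close> does.\<close>
  then have lifts: "lifts p n y = lifts p n h0"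
    unfolding lifts_def by (meson cong_sym cong_trans)
  define f where "f c = reduction (p ^ 2) n (\<lambda>i. h0 i + int p * c i)" for c
  have bij: "bij_betw f (words p n) (lifts p n y)"
    unfolding f_def lifts by (rule bij_betw_lifts[OF p0])
  have f: "[f c i = h0 i + int p * c i] (mod (int p)\<^sup>2)" if "i < n" for c i
    unfolding f_def by (rule reduction_square_cong[OF that])
  have fC: "f c \<in> C \<longleftrightarrow> c \<in> C2" if "c \<in> words p n" for c
    unfolding embedding_in_code_iff[OF that tor, symmetric]
  proof
    assume "f c \<in> C"
    then show "embedding p n c \<in> C"
    proof (rule code_lincomb_mem[OF q1 code _ h0(1) embedding_in_words, where a = 1 and b = "- 1"])
      fix i assume i: "i < n"
      have "[1 * f c i + - 1 * h0 i = 1 * (h0 i + int p * c i) + - 1 * h0 i] (mod (int p)\<^sup>2)"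
        by (intro cong_add cong_mult cong_refl f i)
      then show "[1 * f c i + - 1 * h0 i = embedding p n c i] (mod int (p ^ 2))"
        using cong_trans cong_sym[OF embedding_cong[OF i, of c]] by fastforce
    qed
  next
    assume e: "embedding p n c \<in> C"
    show "f c \<in> C"
    proof (rule code_lincomb_mem[OF q1 code h0(1) e, where a = 1 and b = 1])
      show "f c \<in> words (p ^ 2) n"
        unfolding f_def by (rule reduction_in_words[OF q0])
      fix i assume i: "i < n"
      have "[h0 i + embedding p n c i = h0 i + int p * c i] (mod (int p)\<^sup>2)"
        by (intro cong_add cong_refl embedding_cong i)
      then show "[1 * h0 i + 1 * embedding p n c i = f c i] (mod int (p ^ 2))"
        using cong_trans cong_sym[OF f[OF i, of c]] by fastforce
    qed
  qed
  have "f ` C2 = lifts p n y \<inter> C"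
  proof (intro equalityI subsetI)
    show "h \<in> lifts p n y \<inter> C" if "h \<in> f ` C2" for h
      using that C2_words fC bij_betwE[OF bij] by auto
    show "h \<in> f ` C2" if h: "h \<in> lifts p n y \<inter> C" for h
    proof -
      have "h \<in> f ` words p n"
        using h bij by (simp add: bij_betw_def)
      then show ?thesis using h fC by auto
    qed
  qed
  moreover have "inj_on f C2"
    using bij C2_words unfolding bij_betw_def by (blast intro: inj_on_subset)
  ultimately show ?thesis
    using card_image by metis
qed

text \<open>Double counting of the pairs of a code and a lift of the basis \<open>x\<close> inside it.\<close>

lemma card_lift_tuples_eq:
  "card (lift_tuples p n k x) = card (self_orthogonal_lifts p n C1 C2) * card C2 ^ k"
proof -
  let ?S = "self_orthogonal_lifts p n C1 C2"
  \<comment> \<open>The tuples of lifts with all entries in \<open>C\<close>; they are orthogonal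
    because \<open>C\<close> is self-orthogonal.\<close>
  define Tup where "Tup C = (\<Pi>\<^sub>E j\<in>{..<k}. lifts p n (x j) \<inter> C)" for C
  have Tup: "g \<in> lift_tuples p n k x" if "C \<in> ?S" "g \<in> Tup C" for C g
  proof -
    have gC: "g j \<in> C" if "j < k" for j
      using \<open>g \<in> Tup C\<close> that by (auto simp: Tup_def)
    have "is_code (p ^ 2) n C" "self_orthogonal (p ^ 2) n C"
      using that by (auto simp: self_orthogonal_lifts_def)
    then have "(int p)\<^sup>2 dvd dot n (g i) (g j)" if "i < k" "j < k" for i j
      using self_orthogonal_iff[OF q1, of n C] gC that by simp
    then show ?thesis
      using \<open>g \<in> Tup C\<close> by (auto simp: Tup_def lift_tuples_def PiE_iff)
  qed
  have mem: "g j \<in> C" if "g \<in> Tup C" "j < k" for g j C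
    using that by (auto simp: Tup_def)
  have "?S \<subseteq> Pow (words (p ^ 2) n)"
    using code_subset_words[OF q1] by (auto simp: self_orthogonal_lifts_def)
  then have finS: "finite ?S"
    using finite_words finite_subset by blast
  have "lift_tuples p n k x = (\<Union>C\<in>?S. Tup C)"
  proof (intro equalityI subsetI)
    fix g assume g: "g \<in> lift_tuples p n k x"
    \<comment> \<open>Every orthogonal tuple lies in the code that it generates together with
      \<open>p C2\<close>.\<close>
    have "g \<in> Tup (lift_code p n k C2 g)"
      using g g_in_lift_code[OF g] by (auto simp: Tup_def lift_tuples_def PiE_iff)
    then show "g \<in> (\<Union>C\<in>?S. Tup C)"
      using lift_code_in_self_orthogonal_lifts[OF g] by blast
  qed (use Tup in blast)
  also have "card \<dots> = (\<Sum>C\<in>?S. card (Tup C))"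
  proof (rule card_UN_disjoint[OF finS])
    show "\<forall>C\<in>?S. finite (Tup C)"
      unfolding Tup_def using finite_lifts by (auto intro!: finite_PiE)
    show "\<forall>C\<in>?S. \<forall>D\<in>?S. C \<noteq> D \<longrightarrow> Tup C \<inter> Tup D = {}"
    proof (intro ballI impI, rule ccontr)
      fix C D assume CD: "C \<in> ?S" "D \<in> ?S" "C \<noteq> D" and "Tup C \<inter> Tup D \<noteq> {}"
      then obtain g where g: "g \<in> Tup C" "g \<in> Tup D" by blast
      \<comment> \<open>Both codes contain \<open>g\<close>, and both therefore equal the code
        generated by \<open>g\<close> and \<open>p C2\<close>.\<close>
      have "C = D"
        using lift_code_unique[OF Tup[OF CD(1) g(1)] CD(1) mem[OF g(1)]]
          lift_code_unique[OF Tup[OF CD(1) g(1)] CD(2) mem[OF g(2)]] by simp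
      with CD(3) show False ..
    qed
  qed
  \<comment> \<open>Inside one code the \<open>k\<close> entries are chosen independently, each from
    a coset of \<open>p C2\<close>.\<close>
  also have "\<dots> = (\<Sum>C\<in>?S. card C2 ^ k)"
  proof (rule sum.cong[OF refl])
    fix C assume "C \<in> ?S"
    then show "card (Tup C) = card C2 ^ k"
      using card_lifts_in_code xC by (simp add: Tup_def card_PiE)
  qed
  finally show ?thesis by simp
qed

end

section \<open>Weights of binary words and the final exponent\<close>

lemma dot_self_binary:
  assumes "x \<in> words 2 n"
  shows "dot n x x = int (hamming_weight n x)"
proof -
  have "x i * x i = (if x i \<noteq> 0 then 1 else 0)" if "i < n" for i
  proof -
    have "x i \<in> {0..<2}"
      using PiE_mem[OF assms[unfolded words_def], of i] that by simp
    then have "x i = 0 \<or> x i = 1" by auto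
    then show ?thesis by auto
  qed
  then have "dot n x x = (\<Sum>i<n. if x i \<noteq> 0 then 1 else 0)"
    by (simp add: dot_def)
  also have "\<dots> = int (hamming_weight n x)"
    by (simp add: hamming_weight_def sum.If_cases Int_def)
  finally show ?thesis .
qed

text \<open>Stated over the reals, where \<open>k - 1\<close> is not truncated at
  \<open>k = 0\<close>.\<close>

lemma sum_add_const_real: "real (\<Sum>j<k. j + e) = real k * (real k - 1) / 2 + real k * real e"
  by (induction k) (simp_all add: field_simps)

theorem theorem4p5:
  fixes p n k1 k2 :: nat and C1 C2 :: "(nat \<Rightarrow> int) set"
  assumes "prime p"
    and "is_code p n C1" and "is_code p n C2"
    and "C1 \<subseteq> C2" and "C2 \<subseteq> dual_code p n C1"
    and "code_dim p n C1 = k1" and "code_dim p n C2 = k1 + k2"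
    and "p = 2 \<Longrightarrow> doubly_even n C1"
  shows "real (card {C. is_code (p ^ 2) n C \<and> self_orthogonal (p ^ 2) n C \<and>
                        residue_code p n C = C1 \<and> torsion_code p n C = C2}) =
         (if p = 2
          then 2 powr (real k1 * (2 * real n - 3 * real k1 + 1 - 2 * real k2) / 2)
          else real p powr (real k1 * (2 * real n - 3 * real k1 - 1 - 2 * real k2) / 2))"
proof -
  from code_basis[OF assms(1,2,6)] obtain x where x: "\<And>j. j < k1 \<Longrightarrow> x j \<in> C1"
    "lin_indep_mod p n k1 x"
    "\<And>w. w \<in> C1 \<Longrightarrow> \<exists>a. \<forall>i<n. [w i = (\<Sum>j<k1. a j * x j i)] (mod int p)"
    by blast
  interpret code_pair p n k1 C1 C2 x
    using assms x by unfold_locales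
  define N where "N = card (self_orthogonal_lifts p n C1 C2)"
  define e :: nat where "e = (if p = 2 then 0 else 1)"
  \<comment> \<open>Entries of binary words are their own squares, so the self-product is the
    Hamming weight, which doubly evenness makes a multiple of 4.\<close>
  have even: "4 dvd dot n (x j) (x j)" if "p = 2" "j < k1" for j
  proof -
    have "dot n (x j) (x j) = int (hamming_weight n (x j))"
      using x(1)[OF that(2)] C1_words that(1) by (intro dot_self_binary) auto
    moreover have "4 dvd hamming_weight n (x j)"
      using assms(8)[OF that(1)] x(1)[OF that(2)] by (simp add: doubly_even_def)
    ultimately show ?thesis by presburger
  qed
  \<comment> \<open>The two counts of orthogonal tuples are equated, with
    \<open>p ^ (k1 + k2)\<close> for the cardinality of \<open>C2\<close>.\<close>
  have "N * p ^ ((k1 + k2) * k1 + (\<Sum>j<k1. j + e)) = p ^ (n * k1)"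
    using card_lift_tuples[OF p indep C1_dot_C2[OF xC subsetD[OF sub xC]] even]
    by (simp add: card_lift_tuples_eq card_code[OF p C2 assms(7)] N_def e_def power_add power_mult)
  then have "real N * real p ^ ((k1 + k2) * k1 + (\<Sum>j<k1. j + e)) = real p ^ (n * k1)"
    by (metis of_nat_mult of_nat_power)
  then have "real N = real p powr (real (n * k1) - real ((k1 + k2) * k1 + (\<Sum>j<k1. j + e)))"
    using p0 by (simp add: powr_diff powr_realpow field_simps del: of_nat_mult of_nat_add of_nat_sum)
  \<comment> \<open>\<open>1 - 2 * e\<close> is \<open>1\<close> for \<open>p = 2\<close> and
    \<open>- 1\<close> for odd \<open>p\<close>, which unites the two exponents.\<close>
  also have "real (n * k1) - real ((k1 + k2) * k1 + (\<Sum>j<k1. j + e))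
      = real k1 * (2 * real n - 3 * real k1 + 1 - 2 * real e - 2 * real k2) / 2"
    unfolding of_nat_add[of "(k1 + k2) * k1"] sum_add_const_real by (simp add: field_simps)
  finally show ?thesis
    by (auto simp: N_def e_def self_orthogonal_lifts_def)
qed

end
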